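(* There is an absolute constant $c>0$ such that for all integers $n\ge 1$ $$ r_3(\mathbb{Z}_4^n) \geq c\,\frac{3^n}{\sqrt{n}}.$$ Consequently there is an absolute constant $c'>0$ such that for all $n\geq 1$ there exists a set $S\subset \mathbb{Z}_4^n$ without proper arithmetic progressions of length $3$ with $|S| \geq c'\, 4^{0.7924\,n}$.
   Context: $\mathbb{Z}_m^n$ denotes the additive group $(\mathbb{Z}/m\mathbb{Z})^n$. A proper arithmetic progression of length $k$ in $\mathbb{Z}_m^n$ is a sequence $x, x+d, \ldots, x+(k-1)d$ (with $x,d\in\mathbb{Z}_m^n$) whose $k$ elements are pairwise distinct. $r_k(\mathbb{Z}_m^n)$ denotes the maximal size of a set $S\subseteq\mathbb{Z}_m^n$ that does not contain a proper arithmetic progression of length $k$. *)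

theory Defs
  imports Complex_Main "HOL-Algebra.Product_Groups"
begin

text \<open>
  The additive group \<open>(\<int>/m\<int>)\<^sup>n\<close>. For \<open>m > 0\<close> its elements are the functions \<open>nat \<Rightarrow> int\<close>
  that take values in \<open>{0..<m}\<close> on \<open>{..<n}\<close> and are \<open>undefined\<close> elsewhere, added
  coordinatewise modulo \<open>m\<close>.
\<close>

definition Zmod_pow :: "nat \<Rightarrow> nat \<Rightarrow> (nat \<Rightarrow> int) monoid"
  where "Zmod_pow m n = product_group {..<n} (\<lambda>_. integer_mod_group m)"

text \<open>
  The group operation is written multiplicatively in the library, so the term
  \<open>x + i d\<close> of a progression is \<open>x \<otimes> d [^] i\<close>.
\<close>

definition proper_AP :: "('a, 'b) monoid_scheme \<Rightarrow> nat \<Rightarrow> 'a list \<Rightarrow> bool"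
  where "proper_AP G k xs \<longleftrightarrow>
    (\<exists>x\<in>carrier G. \<exists>d\<in>carrier G. xs = map (\<lambda>i. x \<otimes>\<^bsub>G\<^esub> (d [^]\<^bsub>G\<^esub> i)) [0..<k]) \<and> distinct xs"

definition AP_free :: "('a, 'b) monoid_scheme \<Rightarrow> nat \<Rightarrow> 'a set \<Rightarrow> bool"
  where "AP_free G k S \<longleftrightarrow> \<not> (\<exists>xs. proper_AP G k xs \<and> set xs \<subseteq> S)"

definition r :: "nat \<Rightarrow> ('a, 'b) monoid_scheme \<Rightarrow> nat"
  where "r k G = Max (card ` {S. S \<subseteq> carrier G \<and> AP_free G k S})"

text \<open>
  The maximum above is over a finite nonempty set in the cases of interest. (For \<open>k = 0\<close>
  no set is free of the empty progression.)
\<close>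

lemma finite_carrier_Zmod_pow: "m > 0 \<Longrightarrow> finite (carrier (Zmod_pow m n))"
  by (auto simp: Zmod_pow_def carrier_integer_mod_group intro!: finite_PiE)

lemma AP_free_empty: "k > 0 \<Longrightarrow> AP_free G k {}"
  by (auto simp: AP_free_def proper_AP_def)

lemma r_attained:
  assumes "m > 0" "k > 0"
  shows "\<exists>S \<subseteq> carrier (Zmod_pow m n). AP_free (Zmod_pow m n) k S \<and> card S = r k (Zmod_pow m n)"
proof -
  let ?F = "{S. S \<subseteq> carrier (Zmod_pow m n) \<and> AP_free (Zmod_pow m n) k S}"
  have "finite ?F"
    using finite_carrier_Zmod_pow[OF assms(1)] by (simp add: finite_subset[of _ "Pow _"] Collect_mono Pow_def)
  moreover have "{} \<in> ?F"
    using AP_free_empty[OF assms(2)] by simp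
  ultimately have "Max (card ` ?F) \<in> card ` ?F"
    by (intro Max_in) auto
  then show ?thesis
    unfolding r_def by auto
qed

end

theory Submission
  imports Defs "HOL-Analysis.Weierstrass_Theorems"
begin

text \<open>
  A progression of three terms with digits in \<open>{0, 1, 2}\<close> has the digit 1 in the middle wherever
  an outer term has it; in a coordinate where the difference is odd, the middle digit is 1 and the
  outer ones are not. So vectors with digits in \<open>{0, 1, 2}\<close> and a fixed number \<open>k\<close> of digits 1
  contain only progressions with even difference, whose outer terms coincide. There are
  \<open>(n choose k) 2 ^ (n - k)\<close> of these vectors, and by Chebyshev's inequality for the binomial
  distribution with parameter \<open>1/3\<close> the largest of these counts is at least of order
  \<open>3 ^ n / sqrt n\<close>. In the second part, the factor \<open>sqrt n\<close> is absorbed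
  because \<open>4 ^ 42 < 3 ^ 53\<close> and \<open>42 / 53 > 0.7924\<close>.
\<close>

section \<open>Coordinatewise arithmetic modulo 4\<close>

lemma carrier_Zmod_pow: "carrier (Zmod_pow m n) = {..<n} \<rightarrow>\<^sub>E carrier (integer_mod_group m)"
  by (simp add: Zmod_pow_def)

lemma Zmod_pow_mult_apply:
  "i < n \<Longrightarrow> (x \<otimes>\<^bsub>Zmod_pow m n\<^esub> y) i = (x i + y i) mod int m"
  by (simp add: Zmod_pow_def)

lemma Zmod_pow_nat_pow_apply:
  "i < n \<Longrightarrow> (d [^]\<^bsub>Zmod_pow m n\<^esub> (j::nat)) i = (int j * d i) mod int m"
proof (induction j)
  case 0
  then show ?case by (simp add: Zmod_pow_def)
next
  case (Suc j)
  then show ?case by (simp add: Zmod_pow_mult_apply algebra_simps mod_simps)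
qed

section \<open>Vectors with digits 0, 1, 2 and a fixed number of digits 1\<close>

definition fixed_ones :: "nat \<Rightarrow> nat \<Rightarrow> (nat \<Rightarrow> int) set"
  where "fixed_ones n k = {x \<in> {..<n} \<rightarrow>\<^sub>E {0, 1, 2}. card {i. i < n \<and> x i = 1} = k}"

lemma fixed_ones_subset_carrier: "fixed_ones n k \<subseteq> carrier (Zmod_pow 4 n)"
  unfolding fixed_ones_def carrier_Zmod_pow carrier_integer_mod_group
  using PiE_mono[of "{..<n}" "\<lambda>_. {0, 1, 2 :: int}" "\<lambda>_. {0..<4}"] by auto

text \<open>Starting from 1, an odd difference makes the third term 3, and a difference congruent to
  2 makes the second term 3. Only a difference divisible by 4 remains.\<close>

lemma AP_mod_4_mid:
  fixes a d :: int
  assumes "a mod 4 = 1" "(a + d) mod 4 \<noteq> 3" "(a + 2 * d) mod 4 \<noteq> 3"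
  shows "(a + d) mod 4 = 1 \<and> (a + 2 * d) mod 4 = 1"
proof -
  obtain b where a: "a = 4 * b + 1"
    using assms(1) by (metis mult_div_mod_eq)
  have "even d" using assms(3) unfolding a by presburger
  then obtain e where d: "d = 2 * e" by blast
  show ?thesis
    using assms(2) unfolding a d by presburger
qed

text \<open>The difference of two even terms is even, so doubling it gives 0 modulo 4.\<close>

lemma AP_mod_4_even:
  fixes a d :: int
  assumes "a mod 4 \<in> {0, 2}" "(a + d) mod 4 \<in> {0, 2}"
  shows "(a + 2 * d) mod 4 = a mod 4"
proof -
  have even_if: "even b" if "b mod 4 \<in> {0, 2}" for b :: int
  proof -
    have "b mod 4 = 0 \<or> b mod 4 = 2" using that by blast
    then show ?thesis by presburger
  qed
  have "even d"
    using even_if[OF assms(1)] even_if[OF assms(2)] by simp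
  then obtain e where "d = 2 * e" by blast
  then show ?thesis by presburger
qed

lemma fixed_ones_AP_free: "AP_free (Zmod_pow 4 n) 3 (fixed_ones n k)"
  unfolding AP_free_def
proof
  let ?G = "Zmod_pow 4 n"
  assume "\<exists>xs. proper_AP ?G 3 xs \<and> set xs \<subseteq> fixed_ones n k"
  then obtain xs where AP: "proper_AP ?G 3 xs" and sub: "set xs \<subseteq> fixed_ones n k"
    by blast
  then obtain x d where xs: "xs = map (\<lambda>i. x \<otimes>\<^bsub>?G\<^esub> (d [^]\<^bsub>?G\<^esub> i)) [0..<3]" and dist: "distinct xs"
    by (auto simp: proper_AP_def)
  define t where "t j = x \<otimes>\<^bsub>?G\<^esub> (d [^]\<^bsub>?G\<^esub> j)" for j :: nat
  have xs_t: "xs = [t 0, t 1, t 2]"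
    by (simp add: xs t_def upt_rec numeral_eq_Suc)
  have t_apply: "t j i = (x i + int j * d i) mod 4" if "i < n" for i j
    using that by (simp add: t_def Zmod_pow_mult_apply Zmod_pow_nat_pow_apply mod_simps)
  have mem: "t 0 \<in> fixed_ones n k" "t 1 \<in> fixed_ones n k" "t 2 \<in> fixed_ones n k"
    using sub by (auto simp: xs_t)
  have dig: "t 0 i \<in> {0,1,2}" "t 1 i \<in> {0,1,2}" "t 2 i \<in> {0,1,2}" if "i < n" for i
    using mem that unfolding fixed_ones_def by blast+
  have mid: "t 1 i = 1" "t 2 i = 1" if "i < n" "t 0 i = 1" for i
    using AP_mod_4_mid[of "x i" "d i"] dig[OF that(1)] that(2)
    unfolding t_apply[OF that(1)] by auto
  have even: "t 2 i = t 0 i" if "i < n" "t 0 i \<noteq> 1" "t 1 i \<noteq> 1" for i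
    using AP_mod_4_even[of "x i" "d i"] dig[OF that(1)] that(2,3)
    unfolding t_apply[OF that(1)] by auto
  \<comment> \<open>By \<open>mid\<close>, the first set lies in the second. Both have
    \<open>k\<close> elements, so the inclusion cannot be strict: the middle term has no further
    digits 1.\<close>
  have "{i. i < n \<and> t 0 i = 1} = {i. i < n \<and> t 1 i = 1}"
  proof (rule card_subset_eq)
    show "{i. i < n \<and> t 0 i = 1} \<subseteq> {i. i < n \<and> t 1 i = 1}"
      using mid(1) by blast
    show "card {i. i < n \<and> t 0 i = 1} = card {i. i < n \<and> t 1 i = 1}"
      using mem(1,2) by (simp add: fixed_ones_def)
  qed simp
  \<comment> \<open>Where \<open>t 0 i\<close> is 1, \<open>mid\<close> applies; elsewhere the
    equality of the two sets keeps 1 out of the middle term, so \<open>even\<close> applies.\<close>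
  then have "t 2 i = t 0 i" if "i < n" for i
    using mid(2)[OF that] even[OF that] that by fastforce
  then have "t 2 = t 0"
    using mem(1,3) unfolding fixed_ones_def by (blast intro: PiE_ext)
  with dist show False
    by (simp add: xs_t)
qed

text \<open>Choose the set \<open>T\<close> of positions of the digit 1; each of the other
  \<open>n - k\<close> positions is 0 or 2. A vector determines its \<open>T\<close>, so the classes
  \<open>F T\<close> are disjoint.\<close>

lemma card_fixed_ones: "card (fixed_ones n k) = (n choose k) * 2 ^ (n - k)"
proof -
  define F :: "nat set \<Rightarrow> (nat \<Rightarrow> int) set"
    where "F T = (\<Pi>\<^sub>E i\<in>{..<n}. if i \<in> T then {1} else {0, 2})" for T
  define K where "K = {T. T \<subseteq> {..<n} \<and> card T = k}"
  have ones: "{i. i < n \<and> x i = 1} = T" if "x \<in> F T" "T \<subseteq> {..<n}" for x T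
    using that unfolding F_def PiE_iff by (fastforce split: if_splits)
  have eq: "fixed_ones n k = (\<Union>T\<in>K. F T)"
  proof (intro equalityI subsetI)
    fix x assume x: "x \<in> fixed_ones n k"
    then have "x \<in> F {i. i < n \<and> x i = 1}" "{i. i < n \<and> x i = 1} \<in> K"
      by (auto simp: fixed_ones_def F_def K_def PiE_iff)
    then show "x \<in> (\<Union>T\<in>K. F T)" by blast
  next
    fix x assume "x \<in> (\<Union>T\<in>K. F T)"
    then obtain T where T: "T \<subseteq> {..<n}" "card T = k" "x \<in> F T"
      by (auto simp: K_def)
    then have "x \<in> {..<n} \<rightarrow>\<^sub>E {0, 1, 2}"
      by (auto simp: F_def PiE_iff split: if_splits)
    then show "x \<in> fixed_ones n k"
      using ones[OF T(3,1)] T(2) by (simp add: fixed_ones_def)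
  qed
  have card_F: "card (F T) = 2 ^ (n - k)" if "T \<in> K" for T
  proof -
    have T: "T \<subseteq> {..<n}" "card T = k" using that by (auto simp: K_def)
    have "card (F T) = (\<Prod>i<n. if i \<in> T then 1 else 2)"
      unfolding F_def by (subst card_PiE) (auto intro!: prod.cong)
    also have "\<dots> = (\<Prod>i\<in>{..<n} - T. 2)"
      by (rule prod.mono_neutral_cong_right) auto
    finally show ?thesis
      using T by (simp add: card_Diff_subset finite_subset)
  qed
  have "card (fixed_ones n k) = (\<Sum>T\<in>K. card (F T))"
    unfolding eq
  proof (rule card_UN_disjoint)
    show "finite K" by (simp add: K_def)
    show "\<forall>T\<in>K. finite (F T)" by (auto simp: F_def intro!: finite_PiE)
    show "\<forall>T\<in>K. \<forall>U\<in>K. T \<noteq> U \<longrightarrow> F T \<inter> F U = {}"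
      using ones unfolding K_def by blast
  qed
  also have "\<dots> = (n choose k) * 2 ^ (n - k)"
    using n_subsets[of "{..<n}" k] by (simp add: card_F K_def)
  finally show ?thesis .
qed

section \<open>A large weight of the binomial distribution\<close>

text \<open>This is the variance of the binomial distribution with parameter \<open>x\<close>, the
  input for Chebyshev's inequality.\<close>

lemma Bernstein_variance:
  "(\<Sum>k\<le>n. (real k - real n * x)\<^sup>2 * Bernstein n k x) = real n * x * (1 - x)"
proof -
  \<comment> \<open>The square is rewritten in terms of \<open>k (k - 1)\<close>, \<open>k\<close>
    and 1, whose sums against the Bernstein polynomials are known.\<close>
  have "(real k - real n * x)\<^sup>2 * Bernstein n k x =
        real k * (real k - 1) * Bernstein n k x
        + (1 - 2 * real n * x) * (real k * Bernstein n k x)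
        + (real n * x)\<^sup>2 * Bernstein n k x" for k
    by (simp add: power2_eq_square algebra_simps)
  then have "(\<Sum>k\<le>n. (real k - real n * x)\<^sup>2 * Bernstein n k x) =
        real n * (real n - 1) * x\<^sup>2 + (1 - 2 * real n * x) * (real n * x) + (real n * x)\<^sup>2"
    by (simp add: sum.distrib flip: sum_distrib_left)
  then show ?thesis
    by (simp add: power2_eq_square algebra_simps)
qed

lemma card_nat_near_le:
  fixes y w :: real
  assumes "w \<ge> 0"
  shows "finite {k. \<bar>real k - y\<bar> \<le> w}" and "card {k. \<bar>real k - y\<bar> \<le> w} \<le> 2 * w + 1"
proof -
  let ?A = "{k. \<bar>real k - y\<bar> \<le> w}"
  have "int ` ?A \<subseteq> {\<lceil>y - w\<rceil>..\<lfloor>y + w\<rfloor>}"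
    by (auto simp: ceiling_le_iff le_floor_iff)
  then have fin: "finite ?A" and le: "card ?A \<le> card {\<lceil>y - w\<rceil>..\<lfloor>y + w\<rfloor>}"
    by (rule inj_on_finite[OF inj_on_of_nat] card_inj_on_le[OF inj_on_of_nat]; simp)+
  show "finite ?A" by (fact fin)
  have "card {\<lceil>y - w\<rceil>..\<lfloor>y + w\<rfloor>} \<le> 2 * w + 1"
    using assms by simp linarith
  then show "card ?A \<le> 2 * w + 1"
    using le by (meson of_nat_le_iff order_trans)
qed

lemma large_Bernstein_third:
  assumes "n \<ge> 1"
  shows "\<exists>k\<le>n. Bernstein n k (1/3) \<ge> 3 / (14 * sqrt (real n))"
proof (rule ccontr)
  define B where "B k = Bernstein n k (1/3)" for k
  assume "\<not> ?thesis"
  then have small: "B k < 3 / (14 * sqrt n)" if "k \<le> n" for k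
    using that by (force simp: B_def)
  have nonneg: "B k \<ge> 0" for k
    by (simp add: B_def Bernstein_nonneg)
  \<comment> \<open>The variance is \<open>2 n / 9\<close>, so this radius is sqrt 2 standard
    deviations and Chebyshev's inequality leaves at most 1/2 outside \<open>J\<close>.\<close>
  define J where "J = {k. \<bar>real k - real n / 3\<bar> \<le> 2 / 3 * sqrt n}"
  have "card J \<le> 2 * (2 / 3 * sqrt n) + 1" and finJ: "finite J"
    unfolding J_def by (rule card_nat_near_le; simp)+
  moreover have "sqrt n \<ge> 1" using assms by simp
  \<comment> \<open>The summand 1 is absorbed into \<open>sqrt n\<close>. Half of the mass on at
    most \<open>7 / 3 * sqrt n\<close> points forces a weight of at least
    \<open>3 / (14 * sqrt n)\<close>.\<close>
  ultimately have cardJ: "card J \<le> 7 / 3 * sqrt n" by linarith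
  have tail: "4 / 9 * real n * B k \<le> (real k - real n / 3)\<^sup>2 * B k" if "k \<notin> J" for k
  proof (rule mult_right_mono[OF _ nonneg])
    have "(2 / 3 * sqrt n)\<^sup>2 \<le> \<bar>real k - real n / 3\<bar>\<^sup>2"
      using that by (intro power_mono) (auto simp: J_def)
    then show "4 / 9 * real n \<le> (real k - real n / 3)\<^sup>2"
      by (simp add: power_mult_distrib power_divide)
  qed
  have "4 / 9 * real n * (\<Sum>k\<in>{..n} - J. B k) \<le> (\<Sum>k\<in>{..n} - J. (real k - real n / 3)\<^sup>2 * B k)"
    unfolding sum_distrib_left by (rule sum_mono) (use tail in auto)
  also have "\<dots> \<le> (\<Sum>k\<le>n. (real k - real n / 3)\<^sup>2 * B k)"
    by (rule sum_mono2) (auto simp: nonneg)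
  also have "\<dots> = 2 / 9 * real n"
    using Bernstein_variance[of n "1/3"] by (simp add: B_def)
  finally have "(\<Sum>k\<in>{..n} - J. B k) \<le> 1 / 2"
    using assms by simp
  moreover have "(\<Sum>k\<le>n. B k) = 1"
    by (simp add: B_def)
  moreover have "(\<Sum>k\<le>n. B k) = (\<Sum>k\<in>{..n} \<inter> J. B k) + (\<Sum>k\<in>{..n} - J. B k)"
    by (rule sum.Int_Diff) simp
  ultimately have half: "(\<Sum>k\<in>{..n} \<inter> J. B k) \<ge> 1 / 2"
    by linarith
  \<comment> \<open>A strict inequality between sums requires a nonempty index set.\<close>
  then have ne: "{..n} \<inter> J \<noteq> {}" by auto
  have "(\<Sum>k\<in>{..n} \<inter> J. B k) < real (card ({..n} \<inter> J)) * (3 / (14 * sqrt n))"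
    using sum_strict_mono[of "{..n} \<inter> J" B "\<lambda>_. 3 / (14 * sqrt n)"] ne small by simp
  also have "\<dots> \<le> (7 / 3 * sqrt n) * (3 / (14 * sqrt n))"
  proof (rule mult_right_mono)
    have "card ({..n} \<inter> J) \<le> card J" using finJ by (simp add: card_mono)
    then show "real (card ({..n} \<inter> J)) \<le> 7 / 3 * sqrt n" using cardJ by linarith
  qed simp
  also have "\<dots> = 1 / 2" using assms by simp
  finally show False using half by simp
qed

text \<open>At 1/3 the Bernstein polynomial is the proportion of vectors over three digits that have
  exactly \<open>k\<close> digits 1, which turns a large weight into a large set
  \<open>fixed_ones n k\<close>.\<close>

lemma Bernstein_third:
  assumes "k \<le> n"
  shows "Bernstein n k (1/3) = real ((n choose k) * 2 ^ (n - k)) / 3 ^ n"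
proof -
  have "(3::real) ^ n = 3 ^ k * 3 ^ (n - k)"
    using assms by (simp flip: power_add)
  then show ?thesis
    by (simp add: Bernstein_def power_divide)
qed

section \<open>The two lower bounds\<close>

lemma card_le_r:
  assumes "m > 0" "S \<subseteq> carrier (Zmod_pow m n)" "AP_free (Zmod_pow m n) k S"
  shows "card S \<le> r k (Zmod_pow m n)"
proof -
  let ?F = "{S. S \<subseteq> carrier (Zmod_pow m n) \<and> AP_free (Zmod_pow m n) k S}"
  have "finite ?F"
    using finite_carrier_Zmod_pow[OF assms(1)] by (simp add: finite_subset[of _ "Pow _"] Collect_mono Pow_def)
  then show ?thesis
    using assms unfolding r_def by (intro Max_ge) auto
qed

lemma r_3_Zmod_4_ge:
  assumes "n \<ge> 1"
  shows "real (r 3 (Zmod_pow 4 n)) \<ge> 3 / 14 * (3 ^ n / sqrt (real n))"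
proof -
  obtain k where "k \<le> n" and k: "Bernstein n k (1/3) \<ge> 3 / (14 * sqrt (real n))"
    using large_Bernstein_third[OF assms] by blast
  then have "3 / (14 * sqrt (real n)) * 3 ^ n \<le> card (fixed_ones n k)"
    by (simp add: Bernstein_third card_fixed_ones pos_le_divide_eq)
  also have "card (fixed_ones n k) \<le> r 3 (Zmod_pow 4 n)"
    by (intro card_le_r fixed_ones_subset_carrier fixed_ones_AP_free) simp
  finally show ?thesis by simp
qed

lemma four_powr_less_three: "(4::real) powr 0.7924 < 3"
proof -
  have "(4::real) powr 0.7924 \<le> 4 powr (42 / 53)"
    by (intro powr_mono) auto
  also have "\<dots> < 3"
  \<comment> \<open>Taking 53rd powers makes both sides integers.\<close>
  proof (rule power_less_imp_less_base)
    have "((4::real) powr (42 / 53)) ^ 53 = 4 powr 42"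
      by (simp add: powr_powr flip: powr_realpow)
    also have "\<dots> = 4 ^ 42"
      using powr_realpow[of "4::real" 42] by simp
    also have "\<dots> < 3 ^ 53" by simp
    finally show "((4::real) powr (42 / 53)) ^ 53 < 3 ^ 53" .
  qed simp
  finally show ?thesis .
qed

text \<open>Bernoulli's inequality gives \<open>(q / b) ^ n\<close> at least linear growth with
  slope \<open>q / b - 1\<close>, and \<open>n\<close> dominates \<open>sqrt n\<close>.\<close>

lemma power_div_sqrt_ge:
  fixes b q :: real
  assumes "0 < b" "b < q" "n \<ge> 1"
  shows "(q / b - 1) * b ^ n \<le> q ^ n / sqrt (real n)"
proof -
  have "sqrt n \<ge> 1" using assms(3) by simp
  then have "sqrt n * 1 \<le> sqrt n * sqrt n"
    by (intro mult_left_mono) auto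
  then have "sqrt n \<le> n" by simp
  then have "(q / b - 1) * sqrt n \<le> real n * (q / b - 1)"
    using assms by (simp add: mult.commute mult_left_mono)
  also have "\<dots> \<le> (1 + (q / b - 1)) ^ n"
    using Bernoulli_inequality[of "q / b - 1" n] assms by simp
  also have "\<dots> = q ^ n / b ^ n"
    by (simp add: power_divide)
  finally show ?thesis
    using assms by (simp add: field_simps)
qed

theorem corollary3p3:
  shows "(\<exists>c::real. c > 0 \<and>
            (\<forall>n::nat. n \<ge> 1 \<longrightarrow> real (r 3 (Zmod_pow 4 n)) \<ge> c * (3 ^ n / sqrt (real n)))) \<and>
         (\<exists>c'::real. c' > 0 \<and>
            (\<forall>n::nat. n \<ge> 1 \<longrightarrow>
              (\<exists>S. S \<subseteq> carrier (Zmod_pow 4 n) \<and> AP_free (Zmod_pow 4 n) 3 S \<and>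
                real (card S) \<ge> c' * 4 powr (0.7924 * real n))))"
proof (intro conjI)
  show "\<exists>c::real. c > 0 \<and>
      (\<forall>n::nat. n \<ge> 1 \<longrightarrow> real (r 3 (Zmod_pow 4 n)) \<ge> c * (3 ^ n / sqrt (real n)))"
    using r_3_Zmod_4_ge by (intro exI[of _ "3 / 14"]) simp
next
  \<comment> \<open>The target is a multiple of \<open>b ^ n\<close>. Since \<open>b < 3\<close>,
    the factor \<open>3 / b - 1\<close> is positive and serves, times 3/14, as the constant.\<close>
  define b :: real where "b = 4 powr 0.7924"
  have b: "0 < b" "b < 3"
    using four_powr_less_three by (simp_all add: b_def)
  have "\<exists>S. S \<subseteq> carrier (Zmod_pow 4 n) \<and> AP_free (Zmod_pow 4 n) 3 S \<and>
      real (card S) \<ge> 3 / 14 * (3 / b - 1) * 4 powr (0.7924 * real n)" if "n \<ge> 1" for n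
  proof -
    obtain S where S: "S \<subseteq> carrier (Zmod_pow 4 n)" "AP_free (Zmod_pow 4 n) 3 S"
        "card S = r 3 (Zmod_pow 4 n)"
      using r_attained[of 4 3 n] by auto
    have "3 / 14 * (3 / b - 1) * 4 powr (0.7924 * real n) = 3 / 14 * ((3 / b - 1) * b ^ n)"
      by (simp add: b_def powr_powr flip: powr_realpow)
    also have "\<dots> \<le> 3 / 14 * (3 ^ n / sqrt n)"
      using power_div_sqrt_ge[OF b that] by simp
    also have "\<dots> \<le> card S"
      using r_3_Zmod_4_ge[OF that] by (simp add: S(3))
    finally show ?thesis using S by blast
  qed
  then show "\<exists>c'::real. c' > 0 \<and>
      (\<forall>n::nat. n \<ge> 1 \<longrightarrow>
        (\<exists>S. S \<subseteq> carrier (Zmod_pow 4 n) \<and> AP_free (Zmod_pow 4 n) 3 S \<and>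
          real (card S) \<ge> c' * 4 powr (0.7924 * real n)))"
    using b by (intro exI[of _ "3 / 14 * (3 / b - 1)"]) (simp add: pos_less_divide_eq)
qed

end
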